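(* In the setting described in the context, let $\delta^j=(\delta^j_0,\dots,\delta^j_{N-1})$, $j\in\mathbb N$, be a sequence in $(0,\infty)^N$ with $\lim_{j\to\infty}\delta^j_i=0$ for every $i=0,\dots,N-1$, and let $y^j=(y^j_0,\dots,y^j_{N-1})\in Y^N$ be a sequence of noisy data satisfying $$\|y^j_i-y_i\|\le\delta^j_i,\qquad i=0,\dots,N-1,\ j\in\mathbb N.$$ Let $k^j:=k_*(\delta^j,y^j)$ denote the corresponding stopping index, and let $x^{\delta^j}_k$ denote the iterates for noise levels $\delta^j$ and data $y^j$. Then $x^{\delta^j}_{k^j}$ converges, as $j\to\infty$, to a solution of the system $F_i(x)=y_i$, $i=0,\dots,N-1$. Moreover, if $$\ker(F'(x^\dagger))\subseteq\ker(F'(x))\qquad\text{for all }x\in B_\rho(x_0),$$ then $x^{\delta^j}_{k^j}\to x^\dagger$ as $j\to\infty$.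
   Context: Setting. $X,Y$ are Hilbert spaces, $N\ge 1$, $F_i:D_i\subset X\to Y$ for $i=0,\dots,N-1$, $F=(F_0,\dots,F_{N-1}):\bigcap_i D_i\to Y^N$ with derivative $F'(x)=(F_0'(x),\dots,F_{N-1}'(x))$, and $y=(y_0,\dots,y_{N-1})\in Y^N$ are the exact data. $B_r(x)$ denotes the ball of radius $r$ centered at $x$ in $X$. $[k]:=k \bmod N\in\{0,\dots,N-1\}$, and $\mathbb N=\{0,1,2,\dots\}$. Standing assumptions. The operators $F_i$ are continuously Fréchet differentiable, and there are $x_0\in X$, $M>0$, $\rho>0$ such that $B_\rho(x_0)\subset\bigcap_i D_i$ and $\|F_i'(x)\|\le M$ for all $x\in B_\rho(x_0)$ and all $i$. There is $\eta<1/2$ such that $\|F_i(x)-F_i(\bar x)-F_i'(x)(x-\bar x)\|\le \eta\|F_i(x)-F_i(\bar x)\|$ for all $x,\bar x\in B_\rho(x_0)$ and all $i$. There is $x^*\in B_{\rho/2}(x_0)$ with $F(x^* )=y$. The function $\Phi:(0,\infty)\to(0,\infty)$ is continuous, monotonically increasing, bounded by a constant $\alpha_{\max}$, and satisfies $\Phi(s)\le s$ for all $s$. Put $\alpha_{\min}:=\Phi(1/M^2)$. The constant $\tau$ satisfies $\tau\ge 2\,\frac{1+\eta}{1-2\eta}\ge 2$. Iteration (loping Steepest-Descent-Kaczmarz method). Given noise levels $\delta=(\delta_0,\dots,\delta_{N-1})\in(0,\infty)^N$ and data $y^\delta=(y_0^\delta,\dots,y_{N-1}^\delta)\in Y^N$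 with $\|y_i^\delta-y_i\|\le\delta_i$, put $x_0^\delta=x_0$ and $$x_{k+1}^\delta=x_k^\delta-\omega_k\alpha_k s_k,\qquad s_k=F_{[k]}'(x_k^\delta)^*(F_{[k]}(x_k^\delta)-y_{[k]}^\delta),$$ where $\omega_k=1$ if $\|F_{[k]}(x_k^\delta)-y_{[k]}^\delta\|\ge\tau\delta_{[k]}$ and $\omega_k=0$ otherwise; $\alpha_k=\Phi\big(\|s_k\|^2/\|F_{[k]}'(x_k^\delta)s_k\|^2\big)$ if $\omega_k=1$ and $\alpha_k=\alpha_{\min}$ if $\omega_k=0$. Stopping index. $k_*(\delta,y^\delta)$ is the smallest multiple $lN$ of $N$ ($l\in\mathbb N$) such that $x_{lN}^\delta=x_{lN+1}^\delta=\dots=x_{lN+N-1}^\delta$. $x^\dagger$ denotes the $x_0$-minimal norm solution in $B_{\rho/2}(x_0)$, i.e. the solution $x^\dagger\in B_{\rho/2}(x_0)$ of $F(x^\dagger)=y$ with $\|x^\dagger-x_0\|=\inf\{\|x-x_0\|: x\in B_{\rho/2}(x_0),\ F(x)=y\}$; it exists under the standing assumptions.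
   Formalization: The stopping index tests the whole cycle, x_{lN}=...=x_{lN+N}, instead of up to x_{lN+N-1} (for N=1 that would always give k_*=0 and the claim fails); the stopping index is assumed to exist for each j, since it can fail to exist when τ equals its lower bound. *)

theory Defs
  imports "HOL-Analysis.Analysis"
begin

text \<open>
  Hilbert spaces are types of sort {real_inner, complete_space}.  A tuple indexed by
  0, ..., N-1 is a function on nat of which only the values below N are used.  The
  derivatives are given as a family of bounded operators.
\<close>

definition system_solution ::
  "nat \<Rightarrow> (nat \<Rightarrow> 'a set) \<Rightarrow> (nat \<Rightarrow> 'a \<Rightarrow> 'b) \<Rightarrow> (nat \<Rightarrow> 'b) \<Rightarrow> 'a \<Rightarrow> bool"
  where "system_solution N D F y x \<longleftrightarrow> (\<forall>i<N. x \<in> D i \<and> F i x = y i)"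

definition system_kernel ::
  "nat \<Rightarrow> (nat \<Rightarrow> 'a \<Rightarrow> 'a::real_normed_vector \<Rightarrow>\<^sub>L 'b::real_normed_vector) \<Rightarrow> 'a \<Rightarrow> 'a set"
  where "system_kernel N F' x = {h. \<forall>i<N. blinfun_apply (F' i x) h = 0}"

definition min_norm_solution ::
  "nat \<Rightarrow> (nat \<Rightarrow> 'a::real_normed_vector set) \<Rightarrow> (nat \<Rightarrow> 'a \<Rightarrow> 'b) \<Rightarrow> (nat \<Rightarrow> 'b)
    \<Rightarrow> 'a \<Rightarrow> real \<Rightarrow> 'a \<Rightarrow> bool"
  where "min_norm_solution N D F y x0 r xd \<longleftrightarrow>
    xd \<in> ball x0 r \<and> system_solution N D F y xd \<and>
    norm (xd - x0) = (INF x \<in> {x \<in> ball x0 r. system_solution N D F y x}. norm (x - x0))"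

text \<open>
  The Hilbert space adjoint is the library's \<^const>\<open>adjoint\<close>: for a bounded operator between
  Hilbert spaces the adjoint exists and is unique, so the choice in its definition is
  harmless.  In the step function, \<open>i\<close> stands for \<open>k mod N\<close> and \<open>d\<close>, \<open>yd\<close> are the noise
  levels and the noisy data.
\<close>

definition sdk_residual ::
  "(nat \<Rightarrow> 'a \<Rightarrow> 'b) \<Rightarrow> (nat \<Rightarrow> 'b::real_normed_vector) \<Rightarrow> nat \<Rightarrow> 'a \<Rightarrow> 'b"
  where "sdk_residual F yd i x = F i x - yd i"

definition sdk_direction ::
  "(nat \<Rightarrow> 'a \<Rightarrow> 'b) \<Rightarrow> (nat \<Rightarrow> 'a \<Rightarrow> 'a::real_inner \<Rightarrow>\<^sub>L 'b::real_inner) \<Rightarrow> (nat \<Rightarrow> 'b)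
    \<Rightarrow> nat \<Rightarrow> 'a \<Rightarrow> 'a"
  where "sdk_direction F F' yd i x =
    adjoint (blinfun_apply (F' i x)) (sdk_residual F yd i x)"

definition sdk_omega ::
  "(nat \<Rightarrow> 'a \<Rightarrow> 'b::real_normed_vector) \<Rightarrow> real \<Rightarrow> (nat \<Rightarrow> real) \<Rightarrow> (nat \<Rightarrow> 'b)
    \<Rightarrow> nat \<Rightarrow> 'a \<Rightarrow> real"
  where "sdk_omega F \<tau> d yd i x = (if norm (sdk_residual F yd i x) \<ge> \<tau> * d i then 1 else 0)"

definition sdk_alpha ::
  "(nat \<Rightarrow> 'a \<Rightarrow> 'b) \<Rightarrow> (nat \<Rightarrow> 'a \<Rightarrow> 'a::real_inner \<Rightarrow>\<^sub>L 'b::real_inner)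
    \<Rightarrow> (real \<Rightarrow> real) \<Rightarrow> real \<Rightarrow> real \<Rightarrow> (nat \<Rightarrow> real) \<Rightarrow> (nat \<Rightarrow> 'b) \<Rightarrow> nat \<Rightarrow> 'a \<Rightarrow> real"
  where "sdk_alpha F F' \<Phi> M \<tau> d yd i x =
    (if sdk_omega F \<tau> d yd i x = 1
     then \<Phi> ((norm (sdk_direction F F' yd i x))\<^sup>2
              / (norm (blinfun_apply (F' i x) (sdk_direction F F' yd i x)))\<^sup>2)
     else \<Phi> (1 / M\<^sup>2))"

definition sdk_step ::
  "(nat \<Rightarrow> 'a \<Rightarrow> 'b) \<Rightarrow> (nat \<Rightarrow> 'a \<Rightarrow> 'a::real_inner \<Rightarrow>\<^sub>L 'b::real_inner)
    \<Rightarrow> (real \<Rightarrow> real) \<Rightarrow> real \<Rightarrow> real \<Rightarrow> (nat \<Rightarrow> real) \<Rightarrow> (nat \<Rightarrow> 'b) \<Rightarrow> nat \<Rightarrow> 'a \<Rightarrow> 'a"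
  where "sdk_step F F' \<Phi> M \<tau> d yd i x =
    x - (sdk_omega F \<tau> d yd i x * sdk_alpha F F' \<Phi> M \<tau> d yd i x)
        *\<^sub>R sdk_direction F F' yd i x"

primrec sdk_iterate ::
  "nat \<Rightarrow> (nat \<Rightarrow> 'a \<Rightarrow> 'b) \<Rightarrow> (nat \<Rightarrow> 'a \<Rightarrow> 'a::real_inner \<Rightarrow>\<^sub>L 'b::real_inner)
    \<Rightarrow> (real \<Rightarrow> real) \<Rightarrow> real \<Rightarrow> real \<Rightarrow> 'a \<Rightarrow> (nat \<Rightarrow> real) \<Rightarrow> (nat \<Rightarrow> 'b) \<Rightarrow> nat \<Rightarrow> 'a"
  where
    "sdk_iterate N F F' \<Phi> M \<tau> x0 d yd 0 = x0"
  | "sdk_iterate N F F' \<Phi> M \<tau> x0 d yd (Suc k) =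
       sdk_step F F' \<Phi> M \<tau> d yd (k mod N) (sdk_iterate N F F' \<Phi> M \<tau> x0 d yd k)"

text \<open>
  A full cycle starting at \<open>k\<close> consists of the N steps from \<open>x k\<close> to \<open>x (k + N)\<close>; the
  iteration stops at the beginning of the first cycle in which no step changes the iterate.
  The comparison must include \<open>x (k + N)\<close>: if it ended at \<open>x (k + N - 1)\<close>, the last equation
  of the cycle would not be tested, and for N = 1 the stopping index would always be 0.

  This is a relation and not a function because there need not be a stopping index when
  \<open>\<tau>\<close> equals its lower bound \<open>2 * (1 + \<eta>) / (1 - 2 * \<eta>)\<close>.
\<close>

definition cycle_stationary :: "nat \<Rightarrow> (nat \<Rightarrow> 'a) \<Rightarrow> nat \<Rightarrow> bool"
  where "cycle_stationary N x k \<longleftrightarrow> (\<forall>i\<le>N. x (k + i) = x k)"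

definition is_stopping_index :: "nat \<Rightarrow> (nat \<Rightarrow> 'a) \<Rightarrow> nat \<Rightarrow> bool"
  where "is_stopping_index N x k \<longleftrightarrow>
    N dvd k \<and> cycle_stationary N x k \<and>
    (\<forall>m. N dvd m \<and> cycle_stationary N x m \<longrightarrow> k \<le> m)"

end

theory Submission
  imports Defs
begin

text \<open>
  Every step is a step along \<open>s = F'(x)\<^sup>* (F(x) - y)\<close> for one equation, of a length at most that of
  exact line search for the linearized equation.  The tangential cone condition bounds the inner
  product of \<open>s\<close> with the error \<open>x - z\<close> from below by a multiple of the squared residual, up to noise,
  for every solution \<open>z\<close> in the ball, and the bound on the step length keeps the quadratic term below
  that.  Steps are made only where the residual
  dominates the noise, hence the error with respect to \<^emph>\<open>every\<close> solution in the ball is nonincreasing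
  (\<open>step_error_antimono\<close>), and the iterates stay in the ball.

  For exact data the decrease of the squared error is at least a multiple of the squared residual, so
  the squared residuals are summable.  In a Hilbert space a nonincreasing error does not give
  convergence, but the increment of a cycle is nearly orthogonal to the error at any other
  cycle, up to products of residuals (\<open>cycle_increment_inner_le\<close>).  The argument of Hanke, Neubauer
  and Scherzer, stated abstractly in \<open>Cauchy_if_increments_nearly_orthogonal\<close>, then gives a Cauchy
  sequence.  Its limit \<open>x\<close> is a solution (\<open>exact_convergent\<close>).

  For noisy data a fixed number of steps depends continuously on the data at the exact data
  (\<open>iterate_tendsto_exact\<close>).  If the stopping indices are large, run the noisy iteration up to a fixed
  index at which the exact iterate is near \<open>x\<close>; afterwards the error with respect to the solution \<open>x\<close>
  cannot grow.  If a stopping index is used infinitely often, the residuals there are below the noise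
  level, so the exact iterate with this index is a solution and hence already equal to \<open>x\<close>.

  Under the kernel condition the exact iterates move orthogonally to \<open>ker F'(xd)\<close>.  The minimal norm
  solution \<open>xd\<close> satisfies that \<open>xd - x0\<close> is orthogonal to this kernel too, while \<open>xd - x\<close> lies in it;
  therefore \<open>x = xd\<close>.
\<close>

section \<open>Adjoints of bounded operators between Hilbert spaces\<close>

text \<open>First order condition at a minimum, used for the Riesz functional and for norm minimality.\<close>

lemma linear_coefficient_zero_if_quadratic_nonneg:
  fixes a b e :: real
  assumes "e > 0" and nonneg: "\<And>t. \<bar>t\<bar> < e \<Longrightarrow> 0 \<le> t\<^sup>2 * a + 2 * t * b"
  shows "b = 0"
proof -
  have der: "((\<lambda>t. t\<^sup>2 * a + 2 * t * b) has_real_derivative 2 * b) (at 0)"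
    by (auto intro!: derivative_eq_intros)
  show ?thesis
    using DERIV_local_min[OF der \<open>e > 0\<close>] nonneg by simp
qed

text \<open>
  The representing vector is the minimizer of \<open>\<parallel>x\<parallel>\<^sup>2 - 2 * \<phi> x\<close>.  Minimizing sequences are Cauchy by
  the parallelogram law.
\<close>

lemma Riesz_representation:
  fixes \<phi> :: "'a::{real_inner, complete_space} \<Rightarrow> real"
  assumes "bounded_linear \<phi>"
  shows "\<exists>z. \<forall>x. \<phi> x = x \<bullet> z"
proof -
  interpret bounded_linear \<phi> by fact
  define J where "J x = (norm x)\<^sup>2 - 2 * \<phi> x" for x
  define m where "m = Inf (range J)"
  obtain K where K: "\<And>x. norm (\<phi> x) \<le> norm x * K" using bounded by blast
  have J_lower: "- K\<^sup>2 \<le> J x" for x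
  proof -
    have "\<phi> x \<le> norm x * K" using K[of x] by auto
    moreover have "0 \<le> (norm x - K)\<^sup>2" by simp
    ultimately show ?thesis unfolding J_def power2_diff by linarith
  qed
  have m_le: "m \<le> J x" for x
    unfolding m_def using J_lower by (intro cInf_lower) (auto intro!: bdd_belowI[of _ "- K\<^sup>2"])
  have "\<exists>x. J x < m + inverse (real (Suc n))" for n
    using cInf_lessD[of "range J" "m + inverse (real (Suc n))"] unfolding m_def by auto
  then obtain X where X: "\<And>n. J (X n) < m + inverse (real (Suc n))" by metis
  have parallelogram: "(norm (x - z))\<^sup>2 = 2 * J x + 2 * J z - 4 * J ((1/2) *\<^sub>R (x + z))" for x z
    unfolding J_def by (simp add: power2_norm_eq_inner scaleR add algebra_simps inner_commute)
  have gap: "(norm (x - z))\<^sup>2 \<le> 2 * (J x - m) + 2 * (J z - m)" for x z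
    using m_le[of "(1/2) *\<^sub>R (x + z)"] unfolding parallelogram right_diff_distrib by linarith
  have "Cauchy X"
  proof (rule metric_CauchyI)
    fix e :: real assume "e > 0"
    then obtain n0 where n0: "inverse (real (Suc n0)) < e\<^sup>2 / 4"
      using reals_Archimedean[of "e\<^sup>2 / 4"] by auto
    have small: "J (X n) - m < e\<^sup>2 / 4" if "n \<ge> n0" for n
    proof -
      have "inverse (real (Suc n)) \<le> inverse (real (Suc n0))" using that by (simp add: field_simps)
      then show ?thesis using X[of n] n0 by linarith
    qed
    have "dist (X n) (X k) < e" if "n \<ge> n0" "k \<ge> n0" for n k
    proof -
      have "(norm (X n - X k))\<^sup>2 < e\<^sup>2"
        using gap[of "X n" "X k"] small[OF that(1)] small[OF that(2)]
        unfolding right_diff_distrib by linarith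
      then show ?thesis using \<open>e > 0\<close> by (simp add: dist_norm power2_less_imp_less)
    qed
    then show "\<exists>M. \<forall>m\<ge>M. \<forall>n\<ge>M. dist (X m) (X n) < e" by blast
  qed
  then obtain z where z: "X \<longlonglongrightarrow> z" using Cauchy_convergent convergent_def by blast
  have lim1: "(\<lambda>n. J (X n)) \<longlonglongrightarrow> J z"
    unfolding J_def by (intro tendsto_intros tendsto z)
  have lim2: "(\<lambda>n. m + inverse (real (Suc n))) \<longlonglongrightarrow> m + 0"
    by (intro tendsto_intros LIMSEQ_inverse_real_of_nat)
  have Jz: "J z \<le> m"
    using LIMSEQ_le[OF lim1 lim2] X by (auto intro: less_imp_le)
  have "\<phi> x = x \<bullet> z" for x
  proof -
    have "0 \<le> t\<^sup>2 * (norm x)\<^sup>2 + 2 * t * (x \<bullet> z - \<phi> x)" for t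
    proof -
      have "J (z + t *\<^sub>R x) = J z + t\<^sup>2 * (norm x)\<^sup>2 + 2 * t * (x \<bullet> z - \<phi> x)"
        unfolding J_def power2_norm_eq_inner
        by (simp add: scaleR add algebra_simps inner_commute power2_eq_square)
      then show ?thesis using Jz m_le[of "z + t *\<^sub>R x"] by linarith
    qed
    then show ?thesis
      using linear_coefficient_zero_if_quadratic_nonneg[of 1 "(norm x)\<^sup>2" "x \<bullet> z - \<phi> x"] by simp
  qed
  then show ?thesis by blast
qed

text \<open>
  The constant \<^const>\<open>adjoint\<close> is a choice, which has its defining property only after an adjoint
  has been shown to exist.
\<close>

lemma inner_adjoint_blinfun:
  fixes A :: "'a::{real_inner, complete_space} \<Rightarrow>\<^sub>L 'b::real_inner"
  shows "x \<bullet> adjoint (blinfun_apply A) r = A x \<bullet> r"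
proof -
  have "\<exists>z. \<forall>x. A x \<bullet> r = x \<bullet> z" for r
    by (intro Riesz_representation bounded_linear_compose[OF bounded_linear_inner_left])
       (rule blinfun.bounded_linear_right)
  then have "\<exists>A'. \<forall>x r. A x \<bullet> r = x \<bullet> A' r" by metis
  then have "\<forall>x r. A x \<bullet> r = x \<bullet> adjoint (blinfun_apply A) r"
    unfolding adjoint_def by (rule someI_ex)
  then show ?thesis by simp
qed

lemma norm_adjoint_blinfun_le:
  fixes A :: "'a::{real_inner, complete_space} \<Rightarrow>\<^sub>L 'b::real_inner"
  shows "norm (adjoint (blinfun_apply A) r) \<le> norm A * norm r"
proof -
  let ?s = "adjoint (blinfun_apply A) r"
  have "norm ?s * norm ?s = A ?s \<bullet> r"
    by (metis inner_adjoint_blinfun power2_eq_square power2_norm_eq_inner)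
  also have "\<dots> \<le> norm (A ?s) * norm r" by (rule norm_cauchy_schwarz)
  also have "\<dots> \<le> (norm A * norm ?s) * norm r"
    by (intro mult_right_mono norm_blinfun) simp
  finally have "norm ?s * norm ?s \<le> norm ?s * (norm A * norm r)" by (simp add: mult_ac)
  then show ?thesis by (cases "?s = 0") (auto simp: mult_le_cancel_left)
qed

text \<open>
  Bilinearity in the pair of operator and vector gives the joint continuity by which the direction
  depends continuously on the iterate and the data.
\<close>

lemma bounded_bilinear_adjoint_blinfun:
  "bounded_bilinear (\<lambda>(A :: 'a::{real_inner, complete_space} \<Rightarrow>\<^sub>L 'b::real_inner) r.
     adjoint (blinfun_apply A) r)"
proof -
  have eqI: "u = v" if "\<And>x. x \<bullet> u = x \<bullet> v" for u v :: 'a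
    using that vector_eq_ldot[of u v] by blast
  show ?thesis
  proof
    show "\<exists>K. \<forall>(A :: 'a \<Rightarrow>\<^sub>L 'b) r. norm (adjoint (blinfun_apply A) r) \<le> norm A * norm r * K"
      using norm_adjoint_blinfun_le by (intro exI[of _ 1]) auto
  qed (rule eqI; simp add: inner_adjoint_blinfun inner_add_right inner_add_left blinfun.add_left
         blinfun.scaleR_left)+
qed

section \<open>A single step of the method\<close>

text \<open>
  The standing assumptions are imposed on the ball, which all iterates will be shown to stay in.
\<close>

locale sdk_setting =
  fixes N :: nat
    and F :: "nat \<Rightarrow> 'a::{real_inner, complete_space} \<Rightarrow> 'b::real_inner"
    and F' :: "nat \<Rightarrow> 'a \<Rightarrow> 'a \<Rightarrow>\<^sub>L 'b"
    and y :: "nat \<Rightarrow> 'b" and x0 :: 'a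
    and M \<rho> \<eta> \<tau> \<alpha>max :: real and \<Phi> :: "real \<Rightarrow> real"
  assumes N_ge_1: "N \<ge> 1" and M_pos: "M > 0" and \<eta>_nonneg: "0 \<le> \<eta>" and \<eta>_less: "\<eta> < 1 / 2"
    and deriv_continuous: "\<And>i. i < N \<Longrightarrow> continuous_on (ball x0 \<rho>) (F' i)"
    and deriv_bound: "\<And>i x. i < N \<Longrightarrow> x \<in> ball x0 \<rho> \<Longrightarrow> norm (F' i x) \<le> M"
    and tangential_cone: "\<And>i x z. i < N \<Longrightarrow> x \<in> ball x0 \<rho> \<Longrightarrow> z \<in> ball x0 \<rho> \<Longrightarrow>
          norm (F i x - F i z - F' i x (x - z)) \<le> \<eta> * norm (F i x - F i z)"
    and \<Phi>_pos: "\<And>s. s > 0 \<Longrightarrow> \<Phi> s > 0"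
    and \<Phi>_continuous: "continuous_on {0<..} \<Phi>"
    and \<Phi>_mono: "mono_on {0<..} \<Phi>"
    and \<Phi>_le_max: "\<And>s. s > 0 \<Longrightarrow> \<Phi> s \<le> \<alpha>max"
    and \<Phi>_le: "\<And>s. s > 0 \<Longrightarrow> \<Phi> s \<le> s"
    and solvable: "\<exists>z \<in> ball x0 (\<rho> / 2). \<forall>i<N. F i z = y i"
    and \<tau>_ge: "\<tau> \<ge> 2 * ((1 + \<eta>) / (1 - 2 * \<eta>))"
begin

text \<open>
  Solutions are restricted to the ball, where the tangential cone condition compares them with
  the iterates.
\<close>

definition solves :: "'a \<Rightarrow> bool"
  where "solves z \<longleftrightarrow> z \<in> ball x0 \<rho> \<and> (\<forall>i<N. F i z = y i)"

abbreviation direction where "direction \<equiv> sdk_direction F F'"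
abbreviation residual where "residual \<equiv> sdk_residual F"
abbreviation step where "step \<equiv> sdk_step F F' \<Phi> M \<tau>"

definition \<alpha>min :: real where "\<alpha>min = \<Phi> (1 / M\<^sup>2)"

lemma \<alpha>min_pos: "\<alpha>min > 0"
  unfolding \<alpha>min_def using M_pos by (intro \<Phi>_pos) simp

lemma \<alpha>min_le_max: "\<alpha>min \<le> \<alpha>max"
  unfolding \<alpha>min_def using M_pos by (intro \<Phi>_le_max) simp

lemma \<alpha>max_pos: "\<alpha>max > 0"
  using \<alpha>min_pos \<alpha>min_le_max by simp

lemma \<tau>_bound: "2 * (1 + \<eta>) \<le> \<tau> * (1 - 2 * \<eta>)"
  using \<tau>_ge \<eta>_less by (simp add: field_simps)

lemma \<tau>_pos: "\<tau> > 0"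
proof -
  have "0 < 2 * ((1 + \<eta>) / (1 - 2 * \<eta>))" using \<eta>_nonneg \<eta>_less by simp
  then show ?thesis using \<tau>_ge by linarith
qed

text \<open>
  Two-sided comparison of increments of \<open>F i\<close> with their linearization: the first makes
  linearized increments between solutions vanish, the second makes \<open>F i\<close> Lipschitz.
\<close>

lemma linearized_increment_le:
  assumes "i < N" "x \<in> ball x0 \<rho>" "z \<in> ball x0 \<rho>"
  shows "norm (F' i x (x - z)) \<le> (1 + \<eta>) * norm (F i x - F i z)"
  using tangential_cone[OF assms] norm_triangle_ineq2[of "F' i x (x - z)" "F i x - F i z"]
  by (simp add: norm_minus_commute algebra_simps)

lemma increment_le:
  assumes "i < N" "x \<in> ball x0 \<rho>" "z \<in> ball x0 \<rho>"
  shows "norm (F i x - F i z) \<le> M / (1 - \<eta>) * norm (x - z)"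
proof -
  have "norm (F' i x (x - z)) \<le> norm (F' i x) * norm (x - z)" by (rule norm_blinfun)
  also have "\<dots> \<le> M * norm (x - z)"
    by (intro mult_right_mono deriv_bound assms) simp
  finally have "norm (F' i x (x - z)) \<le> M * norm (x - z)" .
  moreover have "norm (F i x - F i z) - norm (F' i x (x - z))
      \<le> norm (F i x - F i z - F' i x (x - z))"
    by (rule norm_triangle_ineq2)
  ultimately have "(1 - \<eta>) * norm (F i x - F i z) \<le> M * norm (x - z)"
    using tangential_cone[OF assms] unfolding left_diff_distrib by linarith
  then show ?thesis using \<eta>_less by (simp add: field_simps)
qed

lemma F_tendsto:
  assumes "i < N" "x \<in> ball x0 \<rho>" "\<And>j. X j \<in> ball x0 \<rho>" "X \<longlonglongrightarrow> x"
  shows "(\<lambda>j. F i (X j)) \<longlonglongrightarrow> F i x"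
proof (rule LIM_zero_cancel, rule Lim_null_comparison)
  show "\<forall>\<^sub>F j in sequentially. norm (F i (X j) - F i x) \<le> M / (1 - \<eta>) * norm (X j - x)"
    using increment_le[OF assms(1,3,2)] by simp
  have "(\<lambda>j. norm (X j - x)) \<longlonglongrightarrow> 0"
    using assms(4) by (simp add: tendsto_norm_zero LIM_zero)
  then show "(\<lambda>j. M / (1 - \<eta>) * norm (X j - x)) \<longlonglongrightarrow> 0"
    by (rule tendsto_mult_right_zero)
qed

lemma inner_direction: "h \<bullet> direction yd i x = F' i x h \<bullet> residual yd i x"
  unfolding sdk_direction_def by (rule inner_adjoint_blinfun)

lemma norm_direction_le:
  assumes "i < N" "x \<in> ball x0 \<rho>"
  shows "norm (direction yd i x) \<le> M * norm (residual yd i x)"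
  unfolding sdk_direction_def
  by (rule order_trans[OF norm_adjoint_blinfun_le])
     (intro mult_right_mono deriv_bound assms norm_ge_zero)

lemma norm_direction_square_le:
  "(norm (direction yd i x))\<^sup>2
     \<le> norm (residual yd i x) * norm (F' i x (direction yd i x))"
  using inner_direction[of "direction yd i x" yd i x]
    norm_cauchy_schwarz[of "F' i x (direction yd i x)" "residual yd i x"]
  by (simp add: power2_norm_eq_inner mult.commute)

text \<open>
  The step size is at most the one of exact line search for the linearized equation,
  \<open>\<parallel>s\<parallel>\<^sup>2 / \<parallel>F' s\<parallel>\<^sup>2\<close>.  This gives the
  bound \<open>a * \<parallel>s\<parallel>\<^sup>2 \<le> \<parallel>r\<parallel>\<^sup>2\<close>, by which the quadratic term of the error is absorbed by the linear
  one.  If \<open>s = 0\<close>, the quotient is 0/0, but then the step does not depend on the step size and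
  \<open>\<alpha>min\<close> may stand for it.
\<close>

lemma effective_step_size:
  assumes "i < N" "x \<in> ball x0 \<rho>"
  obtains a where "0 \<le> a" "a \<le> \<alpha>max"
    and "step d yd i x = x - a *\<^sub>R direction yd i x"
    and "a * (norm (direction yd i x))\<^sup>2 \<le> (norm (residual yd i x))\<^sup>2"
    and "\<tau> * d i \<le> norm (residual yd i x) \<Longrightarrow> \<alpha>min \<le> a"
    and "norm (residual yd i x) < \<tau> * d i \<Longrightarrow> a = 0"
proof -
  define s where "s = direction yd i x"
  define r where "r = residual yd i x"
  consider "norm r < \<tau> * d i" | "\<tau> * d i \<le> norm r" "s = 0" | "\<tau> * d i \<le> norm r" "s \<noteq> 0"
    by linarith
  then show ?thesis
  proof cases
    case 1
    then show ?thesis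
      using that[of 0] \<alpha>max_pos unfolding sdk_step_def sdk_omega_def r_def by auto
  next
    case 2
    then show ?thesis
      using that[of \<alpha>min] \<alpha>min_pos \<alpha>min_le_max unfolding sdk_step_def s_def r_def by auto
  next
    case 3
    define q where "q = (norm s)\<^sup>2 / (norm (F' i x s))\<^sup>2"
    have sq: "(norm s)\<^sup>2 \<le> norm r * norm (F' i x s)"
      unfolding s_def r_def by (rule norm_direction_square_le)
    then have nz: "norm (F' i x s) > 0"
      using 3 by (smt (verit) mult_eq_0_iff norm_ge_zero zero_less_norm_iff zero_less_power)
    then have q_pos: "q > 0" using 3 by (simp add: q_def)
    have "norm (F' i x s) \<le> M * norm s"
      by (rule order_trans[OF norm_blinfun]) (intro mult_right_mono deriv_bound assms norm_ge_zero)
    then have "(norm (F' i x s))\<^sup>2 \<le> (M * norm s)\<^sup>2" by (intro power_mono) auto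
    then have "1 / M\<^sup>2 \<le> q"
      using nz M_pos unfolding q_def by (simp add: field_simps power_mult_distrib)
    then have "\<alpha>min \<le> \<Phi> q"
      unfolding \<alpha>min_def using M_pos q_pos by (intro mono_onD[OF \<Phi>_mono]) auto
    moreover have "\<Phi> q * (norm s)\<^sup>2 \<le> (norm r)\<^sup>2"
    proof -
      have "\<Phi> q * (norm s)\<^sup>2 \<le> q * (norm s)\<^sup>2" using \<Phi>_le[OF q_pos] by (intro mult_right_mono) auto
      also have "\<dots> = ((norm s)\<^sup>2 / norm (F' i x s))\<^sup>2"
        unfolding q_def by (simp add: power_divide power2_eq_square)
      also have "\<dots> \<le> (norm r)\<^sup>2"
        using sq nz by (intro power_mono) (auto simp: field_simps)
      finally show ?thesis .
    qed
    moreover have "step d yd i x = x - \<Phi> q *\<^sub>R s"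
      using 3 unfolding sdk_step_def sdk_alpha_def sdk_omega_def q_def s_def r_def by simp
    ultimately show ?thesis
      using that[of "\<Phi> q"] 3 \<Phi>_le_max[OF q_pos] \<Phi>_pos[OF q_pos] unfolding s_def r_def by auto
  qed
qed

text \<open>
  The direction \<open>s\<close> makes an acute angle with the error \<open>x - z\<close> as long as the residual
  dominates the noise.
\<close>

lemma inner_error_direction_ge:
  assumes i: "i < N" and x: "x \<in> ball x0 \<rho>" and z: "solves z"
    and noise: "norm (yd i - y i) \<le> d i"
  shows "norm (residual yd i x) * ((1 - \<eta>) * norm (residual yd i x) - (1 + \<eta>) * d i)
    \<le> (x - z) \<bullet> direction yd i x"
proof -
  define r where "r = residual yd i x"
  define e where "e = yd i - y i"
  define w where "w = F i x - F i z - F' i x (x - z)"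
  have Fz: "F i x - F i z = r + e"
    using z i unfolding solves_def r_def e_def sdk_residual_def by simp
  have "norm w \<le> \<eta> * norm (r + e)"
    using tangential_cone[OF i x, of z] z unfolding w_def Fz solves_def by simp
  also have "\<dots> \<le> \<eta> * (norm r + d i)"
    using noise norm_triangle_ineq[of r e] \<eta>_nonneg unfolding e_def by (intro mult_left_mono) auto
  finally have w: "norm w \<le> \<eta> * (norm r + d i)" .
  have "(x - z) \<bullet> direction yd i x = (r + e - w) \<bullet> r"
    unfolding inner_direction w_def Fz r_def by simp
  also have "\<dots> = norm r * norm r - (w - e) \<bullet> r"
    by (simp add: inner_diff_left inner_add_left power2_norm_eq_inner[symmetric] power2_eq_square)
  also have "\<dots> \<ge> norm r * norm r - norm (w - e) * norm r"
    using norm_cauchy_schwarz[of "w - e" r] by simp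
  finally have "(x - z) \<bullet> direction yd i x \<ge> norm r * (norm r - norm (w - e))"
    by (simp add: algebra_simps)
  moreover have "norm (w - e) \<le> \<eta> * (norm r + d i) + d i"
    using w noise norm_triangle_ineq4[of w e] unfolding e_def by linarith
  then have "norm r * ((1 - \<eta>) * norm r - (1 + \<eta>) * d i) \<le> norm r * (norm r - norm (w - e))"
    by (intro mult_left_mono) (auto simp: algebra_simps)
  ultimately show ?thesis unfolding r_def by linarith
qed

text \<open>
  Twice the bound on the inner product with the error, minus the quadratic term \<open>a * \<parallel>r\<parallel>\<^sup>2\<close>, turns
  the factor \<open>1 - \<eta>\<close> into \<open>1 - 2 * \<eta>\<close>; this is where \<open>\<eta> < 1 / 2\<close> comes from.
\<close>

lemma step_error_le:
  assumes i: "i < N" and x: "x \<in> ball x0 \<rho>" and z: "solves z"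
    and noise: "norm (yd i - y i) \<le> d i"
    and a: "0 \<le> a" "a * (norm (direction yd i x))\<^sup>2 \<le> (norm (residual yd i x))\<^sup>2"
    and step: "step d yd i x = x - a *\<^sub>R direction yd i x"
  shows "(norm (step d yd i x - z))\<^sup>2 \<le> (norm (x - z))\<^sup>2
    - a * (norm (residual yd i x) * ((1 - 2 * \<eta>) * norm (residual yd i x) - 2 * (1 + \<eta>) * d i))"
proof -
  define s where "s = direction yd i x"
  define r where "r = norm (residual yd i x)"
  have "(norm (step d yd i x - z))\<^sup>2 = (norm ((x - z) - a *\<^sub>R s))\<^sup>2"
    unfolding step s_def by (simp add: algebra_simps)
  also have "\<dots> = (norm (x - z))\<^sup>2 - 2 * (a * ((x - z) \<bullet> s)) + a * (a * (norm s)\<^sup>2)"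
    unfolding power2_norm_eq_inner
    by (simp add: inner_diff_left inner_diff_right inner_commute algebra_simps)
  also have "\<dots> \<le> (norm (x - z))\<^sup>2
      - 2 * (a * (r * ((1 - \<eta>) * r - (1 + \<eta>) * d i))) + a * r\<^sup>2"
  proof -
    have "a * (r * ((1 - \<eta>) * r - (1 + \<eta>) * d i)) \<le> a * ((x - z) \<bullet> s)"
      unfolding r_def s_def by (intro mult_left_mono inner_error_direction_ge i x z noise a)
    moreover have "a * (a * (norm s)\<^sup>2) \<le> a * r\<^sup>2"
      using a unfolding r_def s_def by (intro mult_left_mono) auto
    ultimately show ?thesis by linarith
  qed
  also have "\<dots> = (norm (x - z))\<^sup>2 - a * (r * ((1 - 2 * \<eta>) * r - 2 * (1 + \<eta>) * d i))"
    by (simp add: algebra_simps power2_eq_square)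
  finally show ?thesis unfolding r_def .
qed

text \<open>
  The lower bound on \<open>\<tau>\<close> is what makes the decrease in the previous estimate nonnegative
  whenever a step is made.
\<close>

lemma step_error_antimono:
  assumes i: "i < N" and x: "x \<in> ball x0 \<rho>" and z: "solves z"
    and noise: "norm (yd i - y i) \<le> d i"
  shows "norm (step d yd i x - z) \<le> norm (x - z)"
proof -
  define r where "r = norm (residual yd i x)"
  have d: "0 \<le> d i" using noise norm_ge_zero order_trans by blast
  obtain a where a: "0 \<le> a" "step d yd i x = x - a *\<^sub>R direction yd i x"
    "a * (norm (direction yd i x))\<^sup>2 \<le> (norm (residual yd i x))\<^sup>2"
    "r < \<tau> * d i \<Longrightarrow> a = 0"
    using effective_step_size[OF i x] unfolding r_def by metis
  have "0 \<le> a * (r * ((1 - 2 * \<eta>) * r - 2 * (1 + \<eta>) * d i))"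
  proof (cases "r < \<tau> * d i")
    case False
    have "2 * (1 + \<eta>) * d i \<le> \<tau> * (1 - 2 * \<eta>) * d i"
      using \<tau>_bound d by (intro mult_right_mono)
    also have "\<dots> = (1 - 2 * \<eta>) * (\<tau> * d i)" by simp
    also have "\<dots> \<le> (1 - 2 * \<eta>) * r"
      using False \<eta>_less by (intro mult_left_mono) auto
    finally show ?thesis using a(1) by (intro mult_nonneg_nonneg) (auto simp: r_def)
  qed (use a in simp)
  then have "(norm (step d yd i x - z))\<^sup>2 \<le> (norm (x - z))\<^sup>2"
    using step_error_le[OF i x z noise a(1,3,2)] unfolding r_def by linarith
  then show ?thesis by (simp add: power2_le_iff_abs_le)
qed

lemma exact_step_decrease:
  assumes i: "i < N" and x: "x \<in> ball x0 \<rho>" and z: "solves z"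
  shows "(norm (step (\<lambda>_. 0) y i x - z))\<^sup>2 + \<alpha>min * (1 - 2 * \<eta>) * (norm (F i x - y i))\<^sup>2
    \<le> (norm (x - z))\<^sup>2"
proof -
  define r where "r = norm (F i x - y i)"
  obtain a where a: "0 \<le> a" "step (\<lambda>_. 0) y i x = x - a *\<^sub>R direction y i x"
    "a * (norm (direction y i x))\<^sup>2 \<le> (norm (residual y i x))\<^sup>2" "\<alpha>min \<le> a"
    using effective_step_size[OF i x, of "\<lambda>_. 0" y]
    by (metis mult_zero_right norm_ge_zero)
  have "\<alpha>min * ((1 - 2 * \<eta>) * r\<^sup>2) \<le> a * ((1 - 2 * \<eta>) * r\<^sup>2)"
    using a(4) \<eta>_less by (intro mult_right_mono) auto
  then show ?thesis
    using step_error_le[OF i x z _ a(1,3,2)]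
    unfolding r_def sdk_residual_def by (simp add: power2_eq_square mult_ac)
qed

lemma exact_step_length:
  assumes i: "i < N" and x: "x \<in> ball x0 \<rho>"
  shows "norm (step (\<lambda>_. 0) y i x - x) \<le> \<alpha>max * M * norm (F i x - y i)"
proof -
  obtain a where a: "0 \<le> a" "a \<le> \<alpha>max" "step (\<lambda>_. 0) y i x = x - a *\<^sub>R direction y i x"
    using effective_step_size[OF i x, of "\<lambda>_. 0" y] by metis
  have "norm (step (\<lambda>_. 0) y i x - x) = a * norm (direction y i x)"
    unfolding a(3) using a(1) by simp
  also have "\<dots> \<le> \<alpha>max * (M * norm (residual y i x))"
    using a \<alpha>max_pos by (intro mult_mono norm_direction_le i x) auto
  finally show ?thesis by (simp add: sdk_residual_def)
qed

text \<open>
  An exact step is nearly orthogonal to \<open>w - z\<close> if the residuals at \<open>x\<close> and at \<open>w\<close> are small,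
  since \<open>F' i x (w - z)\<close> splits into the linearized increments from \<open>x\<close> to \<open>z\<close> and to \<open>w\<close>.
\<close>

lemma exact_step_inner_le:
  assumes i: "i < N" and x: "x \<in> ball x0 \<rho>" and w: "w \<in> ball x0 \<rho>" and z: "solves z"
  shows "\<bar>(w - z) \<bullet> (step (\<lambda>_. 0) y i x - x)\<bar>
    \<le> \<alpha>max * (1 + \<eta>) * norm (F i x - y i) * (2 * norm (F i x - y i) + norm (F i w - y i))"
proof -
  define r where "r = norm (F i x - y i)"
  obtain a where a: "0 \<le> a" "a \<le> \<alpha>max" "step (\<lambda>_. 0) y i x = x - a *\<^sub>R direction y i x"
    using effective_step_size[OF i x, of "\<lambda>_. 0" y] by metis
  have zb: "z \<in> ball x0 \<rho>" and Fz: "F i z = y i" using z i by (auto simp: solves_def)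
  have "F' i x (w - z) = F' i x (x - z) - F' i x (x - w)"
    by (simp add: blinfun.diff_right)
  then have "norm (F' i x (w - z)) \<le> norm (F' i x (x - z)) + norm (F' i x (x - w))"
    by (simp add: norm_triangle_ineq4)
  also have "\<dots> \<le> (1 + \<eta>) * norm (F i x - F i z) + (1 + \<eta>) * norm (F i x - F i w)"
    by (intro add_mono linearized_increment_le i x w zb)
  also have "\<dots> = (1 + \<eta>) * (r + norm (F i x - F i w))"
    unfolding Fz r_def by (simp add: algebra_simps)
  also have "\<dots> \<le> (1 + \<eta>) * (2 * r + norm (F i w - y i))"
    using norm_triangle_ineq4[of "F i x - y i" "F i w - y i"] \<eta>_nonneg
    unfolding r_def by (intro mult_left_mono) auto
  finally have lin: "norm (F' i x (w - z)) \<le> (1 + \<eta>) * (2 * r + norm (F i w - y i))" .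
  have "\<bar>(w - z) \<bullet> (step (\<lambda>_. 0) y i x - x)\<bar> = a * \<bar>F' i x (w - z) \<bullet> (F i x - y i)\<bar>"
    unfolding a(3) using a(1) inner_direction[of "w - z" y i x]
    by (simp add: abs_mult sdk_residual_def)
  also have "\<dots> \<le> \<alpha>max * (((1 + \<eta>) * (2 * r + norm (F i w - y i))) * r)"
  proof (intro mult_mono a)
    have "\<bar>F' i x (w - z) \<bullet> (F i x - y i)\<bar> \<le> norm (F' i x (w - z)) * r"
      unfolding r_def by (rule Cauchy_Schwarz_ineq2)
    also have "\<dots> \<le> ((1 + \<eta>) * (2 * r + norm (F i w - y i))) * r"
      using lin unfolding r_def by (intro mult_right_mono) auto
    finally show "\<bar>F' i x (w - z) \<bullet> (F i x - y i)\<bar> \<le> \<dots>" .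
  qed (use \<alpha>max_pos in auto)
  finally show ?thesis unfolding r_def by (simp add: mult_ac)
qed

text \<open>
  At a point left unchanged by a step, the discrepancy principle is satisfied: otherwise the
  direction would vanish while its angle with the error is acute.
\<close>

lemma fixed_step_residual_less:
  assumes i: "i < N" and x: "x \<in> ball x0 \<rho>" and z: "solves z"
    and noise: "norm (yd i - y i) \<le> d i" and d: "d i > 0"
    and fix_x: "step d yd i x = x"
  shows "norm (residual yd i x) < \<tau> * d i"
proof (rule ccontr)
  define r where "r = norm (residual yd i x)"
  assume "\<not> norm (residual yd i x) < \<tau> * d i"
  then have r: "\<tau> * d i \<le> r" by (simp add: r_def)
  then have r_pos: "r > 0" using \<tau>_pos d by (smt (verit) mult_pos_pos)
  obtain a where "step d yd i x = x - a *\<^sub>R direction yd i x" "\<alpha>min \<le> a"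
    using effective_step_size[OF i x] r unfolding r_def by metis
  then have "direction yd i x = 0" using fix_x \<alpha>min_pos by auto
  then have "r * ((1 - \<eta>) * r - (1 + \<eta>) * d i) \<le> 0"
    using inner_error_direction_ge[OF i x z, where d = d and yd = yd] noise unfolding r_def by simp
  then have le: "(1 - \<eta>) * r \<le> (1 + \<eta>) * d i"
    using r_pos by (simp add: mult_le_0_iff)
  have "2 * ((1 + \<eta>) * d i) \<le> \<tau> * (1 - 2 * \<eta>) * d i"
    using mult_right_mono[OF \<tau>_bound, of "d i"] d by simp
  also have "\<dots> = (1 - 2 * \<eta>) * (\<tau> * d i)" by simp
  also have "\<dots> \<le> (1 - 2 * \<eta>) * r"
    using r \<eta>_less by (intro mult_left_mono) auto
  also have "\<dots> = 2 * ((1 - \<eta>) * r) - r" by (simp add: algebra_simps)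
  finally show False using le r_pos by linarith
qed

text \<open>
  Where the exact direction does not vanish, the residual is nonzero, so that the noisy step is
  not loped once the noise is small, and the step size depends continuously on the data.
  Where it does vanish, the step size may jump, but it multiplies a direction tending to 0.
\<close>

lemma step_tendsto:
  assumes i: "i < N" and x: "x \<in> ball x0 \<rho>"
    and X: "\<And>j. X j \<in> ball x0 \<rho>" "X \<longlonglongrightarrow> x"
    and d: "(\<lambda>j. d j i) \<longlonglongrightarrow> 0" and yd: "(\<lambda>j. yd j i) \<longlonglongrightarrow> y i"
  shows "(\<lambda>j. step (d j) (yd j) i (X j)) \<longlonglongrightarrow> step (\<lambda>_. 0) y i x"
proof -
  define s where "s = direction y i x"
  define S where "S j = direction (yd j) i (X j)" for j
  have "(\<lambda>j. F i (X j)) \<longlonglongrightarrow> F i x" by (rule F_tendsto[OF i x X])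
  then have res: "(\<lambda>j. residual (yd j) i (X j)) \<longlonglongrightarrow> residual y i x"
    unfolding sdk_residual_def by (intro tendsto_diff yd)
  have der: "(\<lambda>j. F' i (X j)) \<longlonglongrightarrow> F' i x"
    using continuous_on_tendsto_compose[OF deriv_continuous[OF i] X(2) x] X(1) by simp
  have S: "S \<longlonglongrightarrow> s"
    unfolding S_def s_def sdk_direction_def
    by (rule bounded_bilinear.tendsto[OF bounded_bilinear_adjoint_blinfun der res])
  show ?thesis
  proof (cases "s = 0")
    case True
    have "(\<lambda>j. step (d j) (yd j) i (X j) - X j) \<longlonglongrightarrow> 0"
    proof (rule Lim_null_comparison)
      have "norm (step (d j) (yd j) i (X j) - X j) \<le> \<alpha>max * norm (S j)" for j
        using effective_step_size[OF i X(1)[of j], of "d j" "yd j"] unfolding S_def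
        by (smt (verit) add_diff_cancel_left' diff_add_cancel mult_right_mono norm_ge_zero
              norm_minus_commute norm_scaleR)
      then show "\<forall>\<^sub>F j in sequentially. norm (step (d j) (yd j) i (X j) - X j) \<le> \<alpha>max * norm (S j)"
        by simp
      show "(\<lambda>j. \<alpha>max * norm (S j)) \<longlonglongrightarrow> 0"
        using S True by (intro tendsto_mult_right_zero tendsto_norm_zero) simp
    qed
    then have "(\<lambda>j. (step (d j) (yd j) i (X j) - X j) + X j) \<longlonglongrightarrow> 0 + x"
      by (intro tendsto_add X(2))
    then show ?thesis using True unfolding s_def sdk_step_def by simp
  next
    case False
    define q where "q = (norm s)\<^sup>2 / (norm (F' i x s))\<^sup>2"
    define Q where "Q j = (norm (S j))\<^sup>2 / (norm (F' i (X j) (S j)))\<^sup>2" for j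
    have sq: "(norm s)\<^sup>2 \<le> norm (residual y i x) * norm (F' i x s)"
      unfolding s_def by (rule norm_direction_square_le)
    then have nz: "residual y i x \<noteq> 0" "F' i x s \<noteq> 0"
      using False by auto
    then have q_pos: "q > 0" using False by (simp add: q_def)
    have FS: "(\<lambda>j. F' i (X j) (S j)) \<longlonglongrightarrow> F' i x s" by (rule blinfun.tendsto[OF der S])
    have "Q \<longlonglongrightarrow> q"
      unfolding Q_def q_def using nz by (intro tendsto_divide tendsto_power tendsto_norm S FS) auto
    moreover have "isCont \<Phi> q"
      using \<Phi>_continuous q_pos by (simp add: continuous_on_eq_continuous_at)
    ultimately have "(\<lambda>j. \<Phi> (Q j)) \<longlonglongrightarrow> \<Phi> q" by (rule isCont_tendsto_compose[rotated])
    then have lim: "(\<lambda>j. X j - \<Phi> (Q j) *\<^sub>R S j) \<longlonglongrightarrow> x - \<Phi> q *\<^sub>R s"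
      by (intro tendsto_intros X S)
    have "(\<lambda>j. norm (residual (yd j) i (X j)) - \<tau> * d j i) \<longlonglongrightarrow> norm (residual y i x) - \<tau> * 0"
      by (intro tendsto_intros res d)
    then have "\<forall>\<^sub>F j in sequentially. 0 < norm (residual (yd j) i (X j)) - \<tau> * d j i"
      using nz by (intro order_tendstoD) auto
    then have "\<forall>\<^sub>F j in sequentially. X j - \<Phi> (Q j) *\<^sub>R S j = step (d j) (yd j) i (X j)"
      by eventually_elim (simp add: sdk_step_def sdk_omega_def sdk_alpha_def Q_def S_def)
    moreover have "step (\<lambda>_. 0) y i x = x - \<Phi> q *\<^sub>R s"
      by (simp add: sdk_step_def sdk_omega_def sdk_alpha_def q_def s_def)
    ultimately show ?thesis using lim by (simp add: tendsto_cong)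
  qed
qed

end

section \<open>A criterion for Cauchy sequences in inner product spaces\<close>

text \<open>
  Given two indices, the triangle is routed over an index \<open>n\<close> between them at which \<open>R\<close> is
  minimal.  Expanding \<open>\<parallel>X k - X n\<parallel>\<^sup>2\<close> around \<open>z\<close> leaves a difference of values of a convergent
  sequence and the inner product of \<open>X n - z\<close> with a sum of increments; there \<open>R n\<close> may be
  replaced by \<open>R m\<close>, and a section of the convergent series of the \<open>(R m)\<^sup>2\<close> remains.
\<close>

lemma Cauchy_if_increments_nearly_orthogonal:
  fixes X :: "nat \<Rightarrow> 'a::real_inner" and R :: "nat \<Rightarrow> real"
  assumes decr: "\<And>m. norm (X (Suc m) - z) \<le> norm (X m - z)"
    and R_nonneg: "\<And>m. 0 \<le> R m" and summable: "summable (\<lambda>m. (R m)\<^sup>2)" and C: "0 \<le> C"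
    and inner_le: "\<And>m n. \<bar>(X n - z) \<bullet> (X (Suc m) - X m)\<bar> \<le> C * R m * (R m + R n)"
  shows "Cauchy X"
proof (rule metric_CauchyI)
  fix e :: real assume "e > 0"
  define E where "E m = (norm (X m - z))\<^sup>2" for m
  \<comment> \<open>chosen such that \<open>e' + 4 * C * e' < (e / 2)\<^sup>2\<close>\<close>
  define e' where "e' = e\<^sup>2 / 8 / (1 + 4 * C)"
  have e': "e' > 0" using \<open>e > 0\<close> C by (simp add: e'_def)
  have "decseq E"
    unfolding decseq_Suc_iff E_def using decr by (auto intro!: power_mono)
  then have "convergent E"
    by (rule decseq_convergent[where B = 0]) (auto simp: E_def convergent_def)
  then have "Cauchy E" by (simp add: convergent_Cauchy)
  then obtain n1 where n1: "\<And>m n. m \<ge> n1 \<Longrightarrow> n \<ge> n1 \<Longrightarrow> \<bar>E m - E n\<bar> < e'"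
    using e' by (force dest: metric_CauchyD simp: dist_real_def)
  obtain n2 where n2: "\<And>m n. m \<ge> n2 \<Longrightarrow> \<bar>\<Sum>i=m..<n. (R i)\<^sup>2\<bar> < e'"
    using summable e' unfolding summable_Cauchy by force
  \<comment> \<open>\<open>k\<close> may lie on either side of \<open>n\<close>, as both legs of the triangle are needed.\<close>
  have half: "norm (X k - X n) < e / 2"
    if kl: "max n1 n2 \<le> min k n" "max k n \<le> l" and p: "max n1 n2 \<le> p" "p \<le> min k n"
      and min_R: "\<And>i. p \<le> i \<Longrightarrow> i \<le> l \<Longrightarrow> R n \<le> R i" for k n l p
  proof -
    define a where "a = min k n"
    define b where "b = max k n"
    have "\<bar>(X n - z) \<bullet> (X b - X a)\<bar> = \<bar>\<Sum>i=a..<b. (X n - z) \<bullet> (X (Suc i) - X i)\<bar>"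
      using sum_Suc_diff'[of a b X] unfolding a_def b_def by (simp flip: inner_sum_right)
    also have "\<dots> \<le> (\<Sum>i=a..<b. 2 * C * (R i)\<^sup>2)"
    proof (rule order_trans[OF sum_abs sum_mono])
      fix i assume "i \<in> {a..<b}"
      then have "R n \<le> R i" using min_R kl p unfolding a_def b_def by auto
      then have "C * R i * (R i + R n) \<le> C * R i * (R i + R i)"
        using C R_nonneg by (intro mult_left_mono) auto
      then show "\<bar>(X n - z) \<bullet> (X (Suc i) - X i)\<bar> \<le> 2 * C * (R i)\<^sup>2"
        using inner_le[of n i] by (simp add: power2_eq_square algebra_simps)
    qed
    also have "\<dots> = 2 * C * (\<Sum>i=a..<b. (R i)\<^sup>2)" by (simp add: sum_distrib_left)
    also have "\<dots> \<le> 2 * C * e'"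
      using n2[of a b] kl C unfolding a_def by (intro mult_left_mono) auto
    finally have "\<bar>(X n - z) \<bullet> (X b - X a)\<bar> \<le> 2 * C * e'" .
    moreover have "\<bar>(X n - z) \<bullet> (X n - X k)\<bar> = \<bar>(X n - z) \<bullet> (X b - X a)\<bar>"
      unfolding a_def b_def by (cases "k \<le> n") (auto simp: inner_diff_right max_def min_def)
    ultimately have inner: "(X n - z) \<bullet> (X n - X k) \<le> 2 * C * e'" by linarith
    have "(norm (X k - X n))\<^sup>2 = E k - E n + 2 * ((X n - z) \<bullet> (X n - X k))"
      unfolding E_def power2_norm_eq_inner
      by (simp add: inner_diff_left inner_diff_right inner_commute)
    also have "\<dots> < e' + 4 * C * e'"
      using n1[of k n] kl inner by auto
    also have "\<dots> = e' * (1 + 4 * C)" by (simp add: algebra_simps)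
    also have "\<dots> = e\<^sup>2 / 8" unfolding e'_def using C by (intro nonzero_eq_divide_eq[THEN iffD1]) auto
    also have "\<dots> \<le> (e / 2)\<^sup>2" by (simp add: power_divide)
    finally show ?thesis using \<open>e > 0\<close> by (intro power2_less_imp_less[of _ "e / 2"]) auto
  qed
  have dist: "dist (X k) (X l) < e" if kl: "max n1 n2 \<le> k" "k \<le> l" for k l
  proof -
    obtain n where n: "n \<in> {k..l}" "\<And>i. i \<in> {k..l} \<Longrightarrow> R n \<le> R i"
      using arg_min_if_finite(1)[of "{k..l}" R] arg_min_least[of "{k..l}" _ R] kl
      by (metis atLeastatMost_empty_iff finite_atLeastAtMost leD)
    have "norm (X k - X n) < e / 2"
      using n kl by (intro half[of k n l k]) auto
    moreover have "norm (X l - X n) < e / 2"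
      using n kl by (intro half[of l n l k]) auto
    ultimately show ?thesis
      using norm_triangle_ineq4[of "X k - X n" "X l - X n"] by (simp add: dist_norm)
  qed
  have "dist (X k) (X l) < e" if "k \<ge> max n1 n2" "l \<ge> max n1 n2" for k l
    using dist[of k l] dist[of l k] that by (cases "k \<le> l") (auto simp: dist_commute)
  then show "\<exists>M. \<forall>m\<ge>M. \<forall>n\<ge>M. dist (X m) (X n) < e" by blast
qed

section \<open>The iterates\<close>

context sdk_setting
begin

definition noise_bound :: "(nat \<Rightarrow> real) \<Rightarrow> (nat \<Rightarrow> 'b) \<Rightarrow> bool"
  where "noise_bound d yd \<longleftrightarrow> (\<forall>i<N. norm (yd i - y i) \<le> d i)"

abbreviation iterate where "iterate \<equiv> sdk_iterate N F F' \<Phi> M \<tau> x0"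

lemma N_pos: "0 < N"
  using N_ge_1 by simp

lemma ball_of_near_solution:
  assumes "z \<in> ball x0 (\<rho> / 2)" "norm (x - z) \<le> norm (x0 - z)"
  shows "x \<in> ball x0 \<rho>"
  using assms dist_triangle[of x0 x z] by (simp add: dist_norm norm_minus_commute)

lemma exists_solves:
  obtains z where "z \<in> ball x0 (\<rho> / 2)" "solves z"
proof -
  obtain z where z: "z \<in> ball x0 (\<rho> / 2)" "\<forall>i<N. F i z = y i" using solvable by blast
  have "z \<in> ball x0 \<rho>" using z(1) by (intro ball_of_near_solution[OF z(1)]) simp
  then show ?thesis using that z by (simp add: solves_def)
qed

text \<open>
  A solution within \<open>\<rho> / 2\<close> of \<open>x0\<close> keeps the iterates in the ball: the error with respect to it
  does not grow as long as they are there.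
\<close>

lemma iterate_in_ball:
  assumes "noise_bound d yd"
  shows "iterate d yd k \<in> ball x0 \<rho>"
proof -
  obtain z where z: "z \<in> ball x0 (\<rho> / 2)" "solves z" using exists_solves .
  have "norm (iterate d yd k - z) \<le> norm (x0 - z)"
  proof (induction k)
    case (Suc k)
    have "norm (iterate d yd (Suc k) - z) \<le> norm (iterate d yd k - z)"
      using step_error_antimono[OF _ ball_of_near_solution[OF z(1) Suc] z(2)] assms N_pos
      by (simp add: noise_bound_def)
    then show ?case using Suc by linarith
  qed simp
  then show ?thesis by (rule ball_of_near_solution[OF z(1)])
qed

lemma iterate_error_antimono:
  assumes "noise_bound d yd" "solves z" "k \<le> l"
  shows "norm (iterate d yd l - z) \<le> norm (iterate d yd k - z)"
  using assms(3)
proof (induction rule: dec_induct)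
  case (step n)
  have "norm (iterate d yd (Suc n) - z) \<le> norm (iterate d yd n - z)"
    using step_error_antimono[OF _ iterate_in_ball[OF assms(1)] assms(2)] assms(1) N_pos
    by (simp add: noise_bound_def)
  then show ?case using step by linarith
qed simp

lemma noise_bound_exact: "noise_bound (\<lambda>_. 0) y"
  by (simp add: noise_bound_def)

lemma iterate_tendsto_exact:
  assumes noise: "\<And>j. noise_bound (d j) (yd j)"
    and d: "\<And>i. i < N \<Longrightarrow> (\<lambda>j. d j i) \<longlonglongrightarrow> 0"
  shows "(\<lambda>j. iterate (d j) (yd j) k) \<longlonglongrightarrow> iterate (\<lambda>_. 0) y k"
proof (induction k)
  case (Suc k)
  have yd: "(\<lambda>j. yd j i) \<longlonglongrightarrow> y i" if "i < N" for i
    using noise that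
    by (intro LIM_zero_cancel[OF Lim_null_comparison[OF _ d[OF that]]]) (auto simp: noise_bound_def)
  have "k mod N < N" using N_pos by simp
  then show ?case
    using step_tendsto[OF _ iterate_in_ball[OF noise_bound_exact] iterate_in_ball[OF noise] Suc]
      d yd by simp
qed simp

text \<open>
  A stationary cycle starting at a multiple of \<open>N\<close> applies every one of the \<open>N\<close> steps to the same
  iterate, so that the discrepancy principle holds for all equations there.
\<close>

lemma residual_at_stopping_index:
  assumes noise: "noise_bound d yd" and d: "\<And>i. i < N \<Longrightarrow> d i > 0"
    and stop: "is_stopping_index N (iterate d yd) k" and i: "i < N"
  shows "norm (residual yd i (iterate d yd k)) < \<tau> * d i"
proof -
  obtain z where z: "solves z" using exists_solves .
  have st: "cycle_stationary N (iterate d yd) k" "N dvd k"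
    using stop by (auto simp: is_stopping_index_def)
  have "iterate d yd (k + i) = iterate d yd k" "iterate d yd (k + Suc i) = iterate d yd k"
    using st(1) i unfolding cycle_stationary_def by (auto simp del: add_Suc_right)
  moreover have "(k + i) mod N = i" using st(2) i by auto
  ultimately have "step d yd i (iterate d yd k) = iterate d yd k" by simp
  then show ?thesis
    using fixed_step_residual_less[OF i iterate_in_ball[OF noise] z] noise d i
    by (simp add: noise_bound_def)
qed

section \<open>Convergence for exact data\<close>

definition exact :: "nat \<Rightarrow> 'a" where "exact = iterate (\<lambda>_. 0) y"

text \<open>
  A single step sees one equation only, so the convergence argument treats a cycle as one
  step: its residual \<open>cycle_residual\<close> bounds the residuals of all equations.
\<close>

definition cycle_start :: "nat \<Rightarrow> 'a" where "cycle_start m = exact (m * N)"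

definition cycle_residual :: "nat \<Rightarrow> real"
  where "cycle_residual m = (\<Sum>i<N. norm (F i (exact (m * N + i)) - y i))"

lemma exact_in_ball: "exact k \<in> ball x0 \<rho>"
  unfolding exact_def by (rule iterate_in_ball[OF noise_bound_exact])

lemma exact_step: "i < N \<Longrightarrow> exact (m * N + Suc i) = step (\<lambda>_. 0) y i (exact (m * N + i))"
  unfolding exact_def by simp

lemma cycle_residual_nonneg: "0 \<le> cycle_residual m"
  unfolding cycle_residual_def by (intro sum_nonneg) auto

lemma residual_le_cycle_residual:
  "i < N \<Longrightarrow> norm (F i (exact (m * N + i)) - y i) \<le> cycle_residual m"
  unfolding cycle_residual_def by (rule member_le_sum) auto

lemma cycle_start_Suc_diff:
  "cycle_start (Suc m) - cycle_start m
     = (\<Sum>i<N. step (\<lambda>_. 0) y i (exact (m * N + i)) - exact (m * N + i))"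
proof -
  have "(\<Sum>i<N. step (\<lambda>_. 0) y i (exact (m * N + i)) - exact (m * N + i))
      = (\<Sum>i<N. exact (m * N + Suc i) - exact (m * N + i))"
    by (intro sum.cong) (simp_all add: exact_step del: add_Suc_right)
  also have "\<dots> = exact (m * N + N) - exact (m * N)"
    using sum_lessThan_telescope[of "\<lambda>i. exact (m * N + i)" N] by simp
  finally show ?thesis by (simp add: cycle_start_def add.commute)
qed

lemma distance_within_cycle:
  assumes "i \<le> N"
  shows "norm (exact (m * N + i) - cycle_start m) \<le> \<alpha>max * M * cycle_residual m"
proof -
  define r where "r l = norm (F l (exact (m * N + l)) - y l)" for l
  have "norm (exact (m * N + i) - cycle_start m) \<le> \<alpha>max * M * (\<Sum>l<i. r l)"
    using assms
  proof (induction i)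
    case (Suc i)
    have "norm (exact (m * N + Suc i) - exact (m * N + i)) \<le> \<alpha>max * M * r i"
      using Suc.prems exact_step_length[OF _ exact_in_ball, of i "m * N + i"]
      unfolding r_def by (simp add: exact_step del: add_Suc_right)
    then show ?case
      using Suc norm_triangle_ineq[of "exact (m * N + Suc i) - exact (m * N + i)"
          "exact (m * N + i) - cycle_start m"]
      by (simp add: distrib_left del: add_Suc_right)
  qed (simp add: cycle_start_def)
  also have "\<dots> \<le> \<alpha>max * M * cycle_residual m"
    unfolding cycle_residual_def r_def using assms \<alpha>max_pos M_pos
    by (intro mult_left_mono sum_mono2) auto
  finally show ?thesis .
qed

text \<open>
  The residuals of a cycle are taken at different iterates.  These are close to each other by the
  previous bound, and the Lipschitz bound on \<open>F i\<close> moves all of them to the start of the cycle.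
\<close>

lemma residual_at_cycle_start:
  assumes "i < N"
  shows "norm (F i (cycle_start m) - y i)
    \<le> (1 + M / (1 - \<eta>) * (\<alpha>max * M)) * cycle_residual m"
proof -
  have "norm (F i (cycle_start m) - F i (exact (m * N + i)))
      \<le> M / (1 - \<eta>) * norm (cycle_start m - exact (m * N + i))"
    unfolding cycle_start_def by (intro increment_le exact_in_ball assms)
  also have "\<dots> \<le> M / (1 - \<eta>) * (\<alpha>max * M * cycle_residual m)"
    using distance_within_cycle[of i m] assms M_pos \<eta>_less
    by (intro mult_left_mono) (auto simp: norm_minus_commute)
  finally show ?thesis
    using residual_le_cycle_residual[OF assms, of m]
      norm_triangle_ineq[of "F i (cycle_start m) - F i (exact (m * N + i))"
        "F i (exact (m * N + i)) - y i"]
    by (simp add: algebra_simps)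
qed

text \<open>The decrease of the squared error over all cycles telescopes.\<close>

lemma summable_cycle_residual_square: "summable (\<lambda>m. (cycle_residual m)\<^sup>2)"
proof -
  obtain z where z: "solves z" using exists_solves .
  define c where "c = \<alpha>min * (1 - 2 * \<eta>)"
  have c: "c > 0" using \<alpha>min_pos \<eta>_less by (simp add: c_def)
  define E where "E m = (norm (cycle_start m - z))\<^sup>2" for m
  define r where "r m i = (norm (F i (exact (m * N + i)) - y i))\<^sup>2" for m i
  have "(norm (exact (m * N + i) - z))\<^sup>2 + c * (\<Sum>l<i. r m l) \<le> E m" if "i \<le> N" for m i
    using that
  proof (induction i)
    case (Suc i)
    have "(norm (exact (m * N + Suc i) - z))\<^sup>2 + c * r m i \<le> (norm (exact (m * N + i) - z))\<^sup>2"
      using Suc.prems exact_step_decrease[OF _ exact_in_ball z, of i "m * N + i"]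
      unfolding r_def c_def by (simp add: exact_step del: add_Suc_right)
    then show ?case using Suc by (simp add: distrib_left del: add_Suc_right)
  qed (simp add: E_def cycle_start_def)
  from this[of N] have cycle: "E (Suc m) + c * (\<Sum>l<N. r m l) \<le> E m" for m
    unfolding E_def cycle_start_def by (simp add: add.commute)
  have "summable (\<lambda>m. \<Sum>l<N. r m l)"
  proof (rule bounded_imp_summable)
    show "0 \<le> (\<Sum>l<N. r m l)" for m by (intro sum_nonneg) (simp add: r_def)
    show "(\<Sum>m\<le>n. \<Sum>l<N. r m l) \<le> E 0 / c" for n
    proof -
      have "E (Suc n) + c * (\<Sum>m\<le>n. \<Sum>l<N. r m l) \<le> E 0"
      proof (induction n)
        case (Suc n)
        then show ?case using cycle[of "Suc n"] by (simp add: distrib_left)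
      qed (use cycle[of 0] in simp)
      moreover have "0 \<le> E (Suc n)" by (simp add: E_def)
      ultimately have "c * (\<Sum>m\<le>n. \<Sum>l<N. r m l) \<le> E 0" by linarith
      then show ?thesis using c by (simp add: field_simps)
    qed
  qed
  then have "summable (\<lambda>m. real N * (\<Sum>l<N. r m l))" by (rule summable_mult)
  then show ?thesis
  proof (rule summable_comparison_test')
    show "norm ((cycle_residual m)\<^sup>2) \<le> real N * (\<Sum>l<N. r m l)" for m
      using sum_squared_le_sum_of_squares[of "\<lambda>i. norm (F i (exact (m * N + i)) - y i)" "{..<N}"]
      unfolding cycle_residual_def r_def by (simp add: mult.commute)
  qed
qed

text \<open>
  Near orthogonality holds for each step of cycle \<open>m\<close> with the residual of its own equation at
  the start of cycle \<open>n\<close>; bounding the latter by \<open>cycle_residual n\<close> allows summation over the cycle.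
\<close>

lemma cycle_increment_inner_le:
  assumes z: "solves z"
  shows "\<bar>(cycle_start n - z) \<bullet> (cycle_start (Suc m) - cycle_start m)\<bar>
    \<le> \<alpha>max * (1 + \<eta>) * (3 + M / (1 - \<eta>) * (\<alpha>max * M))
        * cycle_residual m * (cycle_residual m + cycle_residual n)"
proof -
  define K where "K = 1 + M / (1 - \<eta>) * (\<alpha>max * M)"
  define r where "r i = norm (F i (exact (m * N + i)) - y i)" for i
  define B where "B = 2 * cycle_residual m + K * cycle_residual n"
  have K: "K \<ge> 1" using M_pos \<alpha>max_pos \<eta>_less by (simp add: K_def)
  have c: "0 \<le> \<alpha>max * (1 + \<eta>)" using \<alpha>max_pos \<eta>_nonneg by simp
  have "\<bar>(cycle_start n - z) \<bullet> (cycle_start (Suc m) - cycle_start m)\<bar>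
      \<le> (\<Sum>i<N. \<bar>(cycle_start n - z)
            \<bullet> (step (\<lambda>_. 0) y i (exact (m * N + i)) - exact (m * N + i))\<bar>)"
    unfolding cycle_start_Suc_diff inner_sum_right by (rule sum_abs)
  also have "\<dots> \<le> (\<Sum>i<N. \<alpha>max * (1 + \<eta>) * r i * B)"
  proof (rule sum_mono)
    fix i assume "i \<in> {..<N}"
    then have i: "i < N" by simp
    have "\<bar>(cycle_start n - z) \<bullet> (step (\<lambda>_. 0) y i (exact (m * N + i)) - exact (m * N + i))\<bar>
        \<le> \<alpha>max * (1 + \<eta>) * r i * (2 * r i + norm (F i (cycle_start n) - y i))"
      unfolding r_def using exact_in_ball[of "n * N"]
      by (intro exact_step_inner_le[OF i exact_in_ball _ z]) (simp add: cycle_start_def)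
    also have "\<dots> \<le> \<alpha>max * (1 + \<eta>) * r i * B"
      unfolding B_def K_def using c residual_le_cycle_residual[OF i, of m]
      by (intro mult_left_mono add_mono residual_at_cycle_start i) (auto simp: r_def)
    finally show "\<bar>(cycle_start n - z)
        \<bullet> (step (\<lambda>_. 0) y i (exact (m * N + i)) - exact (m * N + i))\<bar> \<le> \<dots>" .
  qed
  also have "\<dots> = \<alpha>max * (1 + \<eta>) * cycle_residual m * B"
    unfolding cycle_residual_def r_def by (simp flip: sum_distrib_left sum_distrib_right)
  also have "\<dots> \<le> \<alpha>max * (1 + \<eta>) * cycle_residual m
      * ((2 + K) * (cycle_residual m + cycle_residual n))"
  proof (intro mult_left_mono)
    have "0 \<le> K * cycle_residual m + 2 * cycle_residual n"
      using K cycle_residual_nonneg by simp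
    then show "B \<le> (2 + K) * (cycle_residual m + cycle_residual n)"
      unfolding B_def by (simp add: algebra_simps)
  qed (use c cycle_residual_nonneg in simp)
  finally show ?thesis unfolding K_def by (simp add: mult_ac add_ac)
qed

text \<open>
  The cycle starts form a Cauchy sequence, and their limit is a solution because the cycle
  residuals tend to 0.  As the error with respect to that solution is nonincreasing along all
  iterates, the iterates inside the cycles follow.
\<close>

lemma exact_convergent:
  obtains x where "solves x" "exact \<longlonglongrightarrow> x"
proof -
  obtain z where z: "z \<in> ball x0 (\<rho> / 2)" "solves z" using exists_solves .
  have "Cauchy cycle_start"
  proof (rule Cauchy_if_increments_nearly_orthogonal[OF _ cycle_residual_nonneg
            summable_cycle_residual_square _ cycle_increment_inner_le[OF z(2)]])
    show "norm (cycle_start (Suc m) - z) \<le> norm (cycle_start m - z)" for m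
      unfolding cycle_start_def exact_def
      by (rule iterate_error_antimono[OF noise_bound_exact z(2)]) simp
    show "0 \<le> \<alpha>max * (1 + \<eta>) * (3 + M / (1 - \<eta>) * (\<alpha>max * M))"
      using \<alpha>max_pos \<eta>_nonneg \<eta>_less M_pos by simp
  qed
  then obtain x where lim: "cycle_start \<longlonglongrightarrow> x" using Cauchy_convergent convergent_def by blast
  have "norm (x - z) \<le> norm (x0 - z)"
  proof (rule Lim_bounded)
    show "(\<lambda>m. norm (cycle_start m - z)) \<longlonglongrightarrow> norm (x - z)"
      by (intro tendsto_intros lim)
    show "\<forall>m\<ge>0. norm (cycle_start m - z) \<le> norm (x0 - z)"
      using iterate_error_antimono[OF noise_bound_exact z(2), of 0]
      unfolding cycle_start_def exact_def by simp
  qed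
  then have x: "x \<in> ball x0 \<rho>" by (rule ball_of_near_solution[OF z(1)])
  have "F i x = y i" if i: "i < N" for i
  proof -
    have R: "cycle_residual \<longlonglongrightarrow> 0"
      using summable_LIMSEQ_zero[OF summable_cycle_residual_square] by simp
    have "norm (F i x - y i) \<le> M / (1 - \<eta>) * norm (x - cycle_start m)
        + (1 + M / (1 - \<eta>) * (\<alpha>max * M)) * cycle_residual m" for m
    proof -
      have "norm (F i x - F i (cycle_start m)) \<le> M / (1 - \<eta>) * norm (x - cycle_start m)"
        unfolding cycle_start_def by (intro increment_le i x exact_in_ball)
      then show ?thesis
        using residual_at_cycle_start[OF i, of m]
          norm_triangle_ineq[of "F i x - F i (cycle_start m)" "F i (cycle_start m) - y i"]
        by simp
    qed
    moreover have "(\<lambda>m. M / (1 - \<eta>) * norm (x - cycle_start m)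
        + (1 + M / (1 - \<eta>) * (\<alpha>max * M)) * cycle_residual m)
      \<longlonglongrightarrow> M / (1 - \<eta>) * norm (x - x) + (1 + M / (1 - \<eta>) * (\<alpha>max * M)) * 0"
      by (intro tendsto_intros lim R)
    ultimately have "norm (F i x - y i) \<le> 0"
      by (intro Lim_bounded2[where N = 0]) auto
    then show ?thesis by simp
  qed
  then have sol: "solves x" using x by (simp add: solves_def)
  have "exact \<longlonglongrightarrow> x"
  proof (rule LIMSEQ_I)
    fix e :: real assume "e > 0"
    then obtain m where m: "norm (cycle_start m - x) < e" using LIMSEQ_D[OF lim] by blast
    have "norm (exact k - x) < e" if "k \<ge> m * N" for k
      using iterate_error_antimono[OF noise_bound_exact sol that] m
      unfolding cycle_start_def exact_def by linarith
    then show "\<exists>k0. \<forall>k\<ge>k0. norm (exact k - x) < e" by blast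
  qed
  then show ?thesis using that sol by blast
qed

section \<open>Vanishing noise\<close>

text \<open>
  An index that is used infinitely often as stopping index must carry an exact iterate solving
  the system, for otherwise the residuals there would not go below the noise level.
\<close>

lemma stopped_at_index_imp_near_limit:
  assumes noise: "\<And>j. noise_bound (d j) (yd j)"
    and d_pos: "\<And>j i. i < N \<Longrightarrow> d j i > 0"
    and d_lim: "\<And>i. i < N \<Longrightarrow> (\<lambda>j. d j i) \<longlonglongrightarrow> 0"
    and stop: "\<And>j. is_stopping_index N (iterate (d j) (yd j)) (kstop j)"
    and lim: "exact \<longlonglongrightarrow> x" and e: "e > 0"
  shows "\<forall>\<^sub>F j in sequentially. kstop j = k \<longrightarrow> norm (iterate (d j) (yd j) (kstop j) - x) < e"
proof -
  have X: "(\<lambda>j. iterate (d j) (yd j) k) \<longlonglongrightarrow> exact k"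
    unfolding exact_def by (rule iterate_tendsto_exact[OF noise d_lim])
  show ?thesis
  proof (cases "solves (exact k)")
    case True
    have "exact l = exact k" if "l \<ge> k" for l
      using iterate_error_antimono[OF noise_bound_exact True that] unfolding exact_def by simp
    then have "\<forall>\<^sub>F l in sequentially. exact l = exact k"
      by (rule eventually_sequentiallyI)
    then have "exact \<longlonglongrightarrow> exact k" by (rule tendsto_eventually)
    then have "x = exact k" using lim LIMSEQ_unique by blast
    then have "\<forall>\<^sub>F j in sequentially. norm (iterate (d j) (yd j) k - x) < e"
      using tendstoD[OF X e] by (simp add: dist_norm)
    then show ?thesis by eventually_elim auto
  next
    case False
    then obtain i where i: "i < N" "F i (exact k) \<noteq> y i"
      using exact_in_ball by (auto simp: solves_def)
    have F_lim: "(\<lambda>j. F i (iterate (d j) (yd j) k)) \<longlonglongrightarrow> F i (exact k)"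
      by (intro F_tendsto i exact_in_ball iterate_in_ball noise X)
    \<comment> \<open>the summand 1 pays for replacing the noisy by the exact data\<close>
    have "(\<lambda>j. norm (F i (iterate (d j) (yd j) k) - y i) - (\<tau> + 1) * d j i)
        \<longlonglongrightarrow> norm (F i (exact k) - y i) - (\<tau> + 1) * 0"
      by (intro tendsto_diff tendsto_norm tendsto_mult tendsto_const F_lim d_lim i)
    then have "\<forall>\<^sub>F j in sequentially.
        0 < norm (F i (iterate (d j) (yd j) k) - y i) - (\<tau> + 1) * d j i"
      by (rule order_tendstoD) (use i in simp)
    then show ?thesis
    proof eventually_elim
      case (elim j)
      have "kstop j \<noteq> k"
      proof
        assume "kstop j = k"
        then have "norm (residual (yd j) i (iterate (d j) (yd j) k)) < \<tau> * d j i"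
          using residual_at_stopping_index[OF noise _ stop i(1)] d_pos by metis
        moreover have "norm (yd j i - y i) \<le> d j i"
          using noise i by (simp add: noise_bound_def)
        ultimately show False
          using elim norm_triangle_ineq[of "residual (yd j) i (iterate (d j) (yd j) k)" "yd j i - y i"]
          by (simp add: sdk_residual_def distrib_right)
      qed
      then show ?case by simp
    qed
  qed
qed

text \<open>
  Fix \<open>m\<close> such that the exact iterate \<open>m\<close> is close to the limit \<open>x\<close>.  For small noise the noisy
  iterate \<open>m\<close> is close to \<open>x\<close> as well and so, by monotonicity of the error with respect to the
  solution \<open>x\<close>, are all later ones.  The finitely many stopping indices below \<open>m\<close> are covered
  by the previous lemma.
\<close>

lemma stopped_iterate_tendsto:
  assumes noise: "\<And>j. noise_bound (d j) (yd j)"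
    and d_pos: "\<And>j i. i < N \<Longrightarrow> d j i > 0"
    and d_lim: "\<And>i. i < N \<Longrightarrow> (\<lambda>j. d j i) \<longlonglongrightarrow> 0"
    and stop: "\<And>j. is_stopping_index N (iterate (d j) (yd j)) (kstop j)"
    and x: "solves x" and lim: "exact \<longlonglongrightarrow> x"
  shows "(\<lambda>j. iterate (d j) (yd j) (kstop j)) \<longlonglongrightarrow> x"
proof (rule tendstoI)
  fix e :: real assume e: "e > 0"
  obtain m where m: "norm (exact m - x) < e" using LIMSEQ_D[OF lim e] by blast
  have "(\<lambda>j. norm (iterate (d j) (yd j) m - x)) \<longlonglongrightarrow> norm (exact m - x)"
    unfolding exact_def by (intro tendsto_intros iterate_tendsto_exact noise d_lim)
  then have late: "\<forall>\<^sub>F j in sequentially. norm (iterate (d j) (yd j) m - x) < e"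
    using m by (rule order_tendstoD)
  have early: "\<forall>\<^sub>F j in sequentially. \<forall>k\<in>{..<m}. kstop j = k \<longrightarrow>
      norm (iterate (d j) (yd j) (kstop j) - x) < e"
    by (intro eventually_ball_finite ballI
        stopped_at_index_imp_near_limit[OF noise d_pos d_lim stop lim e]) simp_all
  from late early show "\<forall>\<^sub>F j in sequentially. dist (iterate (d j) (yd j) (kstop j)) x < e"
  proof eventually_elim
    case (elim j)
    show ?case
    proof (cases "kstop j < m")
      case False
      then have "norm (iterate (d j) (yd j) (kstop j) - x) \<le> norm (iterate (d j) (yd j) m - x)"
        by (intro iterate_error_antimono noise x) simp
      then show ?thesis using elim(1) by (simp add: dist_norm)
    qed (use elim(2) in \<open>simp add: dist_norm\<close>)
  qed
qed

section \<open>The minimal norm solution\<close>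

text \<open>
  All steps are taken in ranges of adjoints, which are orthogonal to the kernels.
\<close>

lemma exact_orthogonal_kernel:
  assumes h: "\<And>x i. x \<in> ball x0 \<rho> \<Longrightarrow> i < N \<Longrightarrow> F' i x h = 0"
  shows "h \<bullet> (exact k - x0) = 0"
proof (induction k)
  case (Suc k)
  have i: "k mod N < N" using N_pos by simp
  obtain a where a: "step (\<lambda>_. 0) y (k mod N) (exact k) = exact k - a *\<^sub>R direction y (k mod N) (exact k)"
    using effective_step_size[OF i exact_in_ball] by metis
  have "h \<bullet> direction y (k mod N) (exact k) = 0"
    by (simp add: inner_direction h[OF exact_in_ball i])
  moreover have "exact (Suc k) = step (\<lambda>_. 0) y (k mod N) (exact k)"
    by (simp add: exact_def)
  ultimately show ?case using Suc a by (simp add: inner_diff_right)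
qed (simp add: exact_def)

text \<open>
  By the tangential cone condition, the solution set near a solution \<open>z\<close> contains a piece of
  the affine space \<open>z + ker F'(z)\<close>, so that norm minimality is a first order condition along
  the kernel.
\<close>

lemma min_norm_solution_orthogonal_kernel:
  assumes z: "z \<in> ball x0 r" "solves z" and r: "r \<le> \<rho>"
    and minimal: "\<And>w. w \<in> ball x0 r \<Longrightarrow> solves w \<Longrightarrow> norm (z - x0) \<le> norm (w - x0)"
    and h: "\<And>i. i < N \<Longrightarrow> F' i z h = 0"
  shows "h \<bullet> (z - x0) = 0"
proof -
  define e where "e = (r - dist x0 z) / (norm h + 1)"
  have e: "e > 0" unfolding e_def using z(1) by (intro divide_pos_pos add_nonneg_pos) auto
  have "0 \<le> t\<^sup>2 * (norm h)\<^sup>2 + 2 * t * (h \<bullet> (z - x0))" if t: "\<bar>t\<bar> < e" for t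
  proof -
    define w where "w = z + t *\<^sub>R h"
    have "\<bar>t\<bar> * norm h \<le> \<bar>t\<bar> * (norm h + 1)" by (intro mult_left_mono) auto
    also have "\<dots> < e * (norm h + 1)" using t by (intro mult_strict_right_mono add_nonneg_pos) auto
    also have "\<dots> = r - dist x0 z"
      unfolding e_def using norm_ge_zero[of h] by (simp add: add_nonneg_eq_0_iff)
    finally have w: "w \<in> ball x0 r"
      using dist_triangle[of x0 w z] by (simp add: w_def dist_norm)
    then have w': "w \<in> ball x0 \<rho>" using r by simp
    \<comment> \<open>a zero linearized increment forces equal values, as \<open>\<eta> < 1\<close>\<close>
    have "F i w = y i" if i: "i < N" for i
    proof -
      have zb: "z \<in> ball x0 \<rho>" and Fz: "F i z = y i" using z i by (auto simp: solves_def)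
      have "F' i z (z - w) = 0" using h[OF i] by (simp add: w_def blinfun.scaleR_right blinfun.minus_right)
      then have "norm (F i z - F i w) \<le> \<eta> * norm (F i z - F i w)"
        using tangential_cone[OF i zb w'] by simp
      also have "\<dots> \<le> 1 / 2 * norm (F i z - F i w)"
        using \<eta>_less by (intro mult_right_mono) auto
      finally show ?thesis using Fz by simp
    qed
    then have "norm (z - x0) \<le> norm (w - x0)"
      using w w' by (intro minimal) (auto simp: solves_def)
    then have "(norm (z - x0))\<^sup>2 \<le> (norm (w - x0))\<^sup>2" by (intro power_mono) auto
    also have "(norm (w - x0))\<^sup>2 = (norm ((z - x0) + t *\<^sub>R h))\<^sup>2"
      by (simp add: w_def algebra_simps)
    also have "\<dots> = (norm (z - x0))\<^sup>2 + (t\<^sup>2 * (norm h)\<^sup>2 + 2 * t * (h \<bullet> (z - x0)))"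
    proof -
      have "(u + t *\<^sub>R h) \<bullet> (u + t *\<^sub>R h) = u \<bullet> u + (t\<^sup>2 * (h \<bullet> h) + 2 * t * (h \<bullet> u))" for u
        by (simp add: inner_add_left inner_add_right inner_commute power2_eq_square algebra_simps)
      then show ?thesis by (simp only: power2_norm_eq_inner)
    qed
    finally show ?thesis by simp
  qed
  then show ?thesis by (rule linear_coefficient_zero_if_quadratic_nonneg[OF e])
qed

text \<open>
  The vector \<open>z - x\<close> lies in \<open>ker F'(z)\<close> because both points have the same image, and it is orthogonal
  to \<open>x - x0\<close> and to \<open>z - x0\<close> by the two previous lemmas, hence to itself.
\<close>

lemma exact_limit_eq_min_norm_solution:
  assumes x: "solves x" "exact \<longlonglongrightarrow> x" and r: "r \<le> \<rho>"
    and z: "z \<in> ball x0 r" "solves z"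
    and minimal: "\<And>w. w \<in> ball x0 r \<Longrightarrow> solves w \<Longrightarrow> norm (z - x0) \<le> norm (w - x0)"
    and kernel: "\<And>w. w \<in> ball x0 \<rho> \<Longrightarrow> system_kernel N F' z \<subseteq> system_kernel N F' w"
  shows "x = z"
proof -
  define h where "h = z - x"
  have h: "F' i z h = 0" if "i < N" for i
    using linearized_increment_le[OF that, of z x] x z that by (simp add: solves_def h_def)
  have "F' i w h = 0" if "w \<in> ball x0 \<rho>" "i < N" for w i
    using kernel[OF that(1)] h that(2) by (auto simp: system_kernel_def)
  then have "(\<lambda>k. h \<bullet> (exact k - x0)) = (\<lambda>_. 0)"
    by (intro ext exact_orthogonal_kernel)
  moreover have "(\<lambda>k. h \<bullet> (exact k - x0)) \<longlonglongrightarrow> h \<bullet> (x - x0)"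
    by (intro tendsto_inner tendsto_diff tendsto_const x(2))
  ultimately have "h \<bullet> (x - x0) = 0"
    by (simp add: LIMSEQ_const_iff)
  moreover have "h \<bullet> (z - x0) = 0"
    by (rule min_norm_solution_orthogonal_kernel[OF z r minimal h])
  ultimately have "h \<bullet> h = 0" by (simp add: h_def inner_diff_right)
  then show ?thesis by (simp add: h_def)
qed

end

theorem theorem3p6:
  fixes N :: nat
    and D :: "nat \<Rightarrow> 'a::{real_inner, complete_space} set"
    and F :: "nat \<Rightarrow> 'a \<Rightarrow> 'b::{real_inner, complete_space}"
    and F' :: "nat \<Rightarrow> 'a \<Rightarrow> 'a \<Rightarrow>\<^sub>L 'b"
    and y :: "nat \<Rightarrow> 'b"
    and x0 :: 'a
    and M \<rho> \<eta> \<tau> \<alpha>max :: real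
    and \<Phi> :: "real \<Rightarrow> real"
    and \<delta> :: "nat \<Rightarrow> nat \<Rightarrow> real"
    and ydata :: "nat \<Rightarrow> nat \<Rightarrow> 'b"
    and kstop :: "nat \<Rightarrow> nat"
  assumes N: "N \<ge> 1"
    and deriv: "\<And>i x. i < N \<Longrightarrow> x \<in> D i \<Longrightarrow>
          (F i has_derivative blinfun_apply (F' i x)) (at x within D i)"
    and deriv_cont: "\<And>i. i < N \<Longrightarrow> continuous_on (D i) (F' i)"
    and M: "M > 0" and \<rho>: "\<rho> > 0"
    and ball_dom: "ball x0 \<rho> \<subseteq> (\<Inter>i<N. D i)"
    and deriv_bound: "\<And>i x. i < N \<Longrightarrow> x \<in> ball x0 \<rho> \<Longrightarrow> norm (F' i x) \<le> M"
    and \<eta>: "\<eta> < 1 / 2"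
    and tangential_cone: "\<And>i x xb. i < N \<Longrightarrow> x \<in> ball x0 \<rho> \<Longrightarrow> xb \<in> ball x0 \<rho> \<Longrightarrow>
          norm (F i x - F i xb - blinfun_apply (F' i x) (x - xb)) \<le> \<eta> * norm (F i x - F i xb)"
    and solvable: "\<exists>xs \<in> ball x0 (\<rho> / 2). system_solution N D F y xs"
    and \<Phi>_pos: "\<And>s. s > 0 \<Longrightarrow> \<Phi> s > 0"
    and \<Phi>_cont: "continuous_on {0<..} \<Phi>"
    and \<Phi>_mono: "mono_on {0<..} \<Phi>"
    and \<Phi>_bounded: "\<And>s. s > 0 \<Longrightarrow> \<Phi> s \<le> \<alpha>max"
    and \<Phi>_le: "\<And>s. s > 0 \<Longrightarrow> \<Phi> s \<le> s"
    and \<tau>: "\<tau> \<ge> 2 * ((1 + \<eta>) / (1 - 2 * \<eta>))"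
    and \<tau>_bound_ge_2: "2 * ((1 + \<eta>) / (1 - 2 * \<eta>)) \<ge> 2"
    and \<delta>_pos: "\<And>j i. i < N \<Longrightarrow> \<delta> j i > 0"
    and \<delta>_lim: "\<And>i. i < N \<Longrightarrow> (\<lambda>j. \<delta> j i) \<longlonglongrightarrow> 0"
    and noise: "\<And>j i. i < N \<Longrightarrow> norm (ydata j i - y i) \<le> \<delta> j i"
    and stop: "\<And>j. is_stopping_index N (sdk_iterate N F F' \<Phi> M \<tau> x0 (\<delta> j) (ydata j)) (kstop j)"
  shows "(\<exists>x. system_solution N D F y x \<and>
            (\<lambda>j. sdk_iterate N F F' \<Phi> M \<tau> x0 (\<delta> j) (ydata j) (kstop j)) \<longlonglongrightarrow> x) \<and>
         (\<forall>xd. min_norm_solution N D F y x0 (\<rho> / 2) xd \<longrightarrow>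
            (\<forall>x \<in> ball x0 \<rho>. system_kernel N F' xd \<subseteq> system_kernel N F' x) \<longrightarrow>
            (\<lambda>j. sdk_iterate N F F' \<Phi> M \<tau> x0 (\<delta> j) (ydata j) (kstop j)) \<longlonglongrightarrow> xd)"
proof -
  \<comment> \<open>the bound on \<open>\<tau>\<close> is at least 2 only if \<open>1 - 2 * \<eta> \<le> 1 + \<eta>\<close>\<close>
  have \<eta>_nonneg: "0 \<le> \<eta>"
    using \<tau>_bound_ge_2 \<eta> by (simp add: field_simps)
  have dom: "x \<in> D i" if "x \<in> ball x0 \<rho>" "i < N" for x i
    using ball_dom that by blast
  interpret sdk_setting N F F' y x0 M \<rho> \<eta> \<tau> \<alpha>max \<Phi>
  proof
    show "continuous_on (ball x0 \<rho>) (F' i)" if "i < N" for i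
      using deriv_cont[OF that] dom[OF _ that] by (meson continuous_on_subset subsetI)
    show "\<exists>z\<in>ball x0 (\<rho> / 2). \<forall>i<N. F i z = y i"
      using solvable by (auto simp: system_solution_def)
  qed (fact N M \<eta>_nonneg \<eta> deriv_bound tangential_cone \<Phi>_pos \<Phi>_cont \<Phi>_mono \<Phi>_bounded \<Phi>_le \<tau>)+
  let ?stopped = "\<lambda>j. sdk_iterate N F F' \<Phi> M \<tau> x0 (\<delta> j) (ydata j) (kstop j)"
  obtain x where x: "solves x" "exact \<longlonglongrightarrow> x" using exact_convergent .
  have lim: "?stopped \<longlonglongrightarrow> x"
    by (rule stopped_iterate_tendsto[OF _ \<delta>_pos \<delta>_lim stop x]) (simp_all add: noise_bound_def noise)
  have sol_iff: "system_solution N D F y w" if "solves w" for w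
    using that dom by (auto simp: system_solution_def solves_def)
  have "x = xd"
    if xd: "min_norm_solution N D F y x0 (\<rho> / 2) xd"
      and kernel: "\<forall>x \<in> ball x0 \<rho>. system_kernel N F' xd \<subseteq> system_kernel N F' x" for xd
  proof (rule exact_limit_eq_min_norm_solution[OF x])
    show "\<rho> / 2 \<le> \<rho>" using \<rho> by simp
    show "xd \<in> ball x0 (\<rho> / 2)" using xd by (simp add: min_norm_solution_def)
    then show "solves xd"
      using xd \<rho> by (auto simp: min_norm_solution_def system_solution_def solves_def)
    show "norm (xd - x0) \<le> norm (w - x0)" if w: "w \<in> ball x0 (\<rho> / 2)" "solves w" for w
    proof -
      have "(INF x \<in> {x \<in> ball x0 (\<rho> / 2). system_solution N D F y x}. norm (x - x0))
          \<le> norm (w - x0)"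
        using w sol_iff by (intro cINF_lower) (auto intro!: bdd_belowI[of _ 0])
      then show ?thesis using xd by (simp add: min_norm_solution_def)
    qed
  qed (use kernel in blast)
  then show ?thesis using lim sol_iff[OF x(1)] by blast
qed

end
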